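(* Let $G$ be an undirected graph on $n$ vertices with nonnegative edge weights in which every vertex has positive degree, let $\psi>0$ and $1\le q<n$. Let $\lambda_1\ge\cdots\ge\lambda_n$ be the eigenvalues (with multiplicity) of $\hat{A}-\mathbf{k}\mathbf{k}^t$, and let $\mathbf{v}_1,\dots,\mathbf{v}_q$ be orthonormal vectors, orthogonal to $\mathbf{k}$, with $\hat{A}\mathbf{v}_j=\lambda_j\mathbf{v}_j$ for $j=1,\dots,q$. Define $V=\mathrm{Span}\{D^{-1/2}\mathbf{v}_1,\dots,D^{-1/2}\mathbf{v}_q\}$ and $$g=\inf_{\mathbf{v}\in V,\ \|\mathbf{v}\|_2=1} g_{\mathbf{v}} .$$ Let $\mathbf{x}\in\mathbb{R}^n$ be a unit vector orthogonal to $\mathbf{k}$, let $\mu=\mathbf{x}^t\hat{A}\mathbf{x}$ and $\delta_{1,q}(\mu)=\min_{k>q}|\lambda_k-\mu|$. If $$\|\hat{A}\mathbf{x}-\mu\mathbf{x}\|_2<\frac{1}{\sqrt{2}}\sqrt{\frac{d_{\min}}{d_{\max}}}\;\delta_{1,q}(\mu)\,g ,$$ then $\phi(D^{-1/2}\mathbf{x})\le\psi$.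
   Context: Let $A=(a_{i,j})$ be the (weighted) adjacency matrix of $G$, $D$ the diagonal matrix of degrees $d_{i,i}=(A\mathbf{1})_i$ ($\mathbf{1}$ is the all-ones vector), $d_{\min},d_{\max}$ the minimum and maximum degree, $\hat{A}=D^{-1/2}AD^{-1/2}$, and $\mathbf{k}=D^{1/2}\mathbf{1}/\|D^{1/2}\mathbf{1}\|_2$ (so $\hat{A}\mathbf{k}=\mathbf{k}$). For a nonempty proper subset $S$ of the vertex set, with complement $\bar S$, put $\mathrm{Vol}(S)=\sum_{i,j\in S}a_{i,j}$, $E(S,\bar S)=\sum_{i\in S,j\notin S}a_{i,j}$ and $\phi(S)=E(S,\bar S)/\min(\mathrm{Vol}(S),\mathrm{Vol}(\bar S))$ (with $\phi(S)=+\infty$ when the denominator is $0$). For a vector $\mathbf{y}\in\mathbb{R}^n$ the sweep cut at $t\in\mathbb{R}$ is $S_{\mathbf{y}}(t)=\{i: y_i>t\}$; only nonempty proper sweep cuts are considered. $\phi(\mathbf{y})=\min_t\phi(S_{\mathbf{y}}(t))$ is the minimal conductance of a sweep cut of $\mathbf{y}$ (taken as $+\infty$ if there is no nonempty proper sweep cut). For $\mathbf{v}\in\mathbb{R}^n$ let $T_\psi(\mathbf{v})=\{t: S_{\mathbf{v}}(t)\text{ is nonempty and proper and }\phi(S_{\mathbf{v}}(t))\le\psi\}$ and $g_{\mathbf{v}}=\max_{t\in T_\psi(\mathbf{v})}\min_i|v_i-t|$, with $g_{\mathbf{v}}=0$ if $T_\psi(\mathbf{v})=\emptyset$. *)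

theory Defs
  imports "HOL-Analysis.Analysis"
begin

text \<open>
  A weighted undirected graph on the vertex type \<open>'n\<close> is given by its adjacency matrix.
  Loops, that is nonzero diagonal entries, are allowed.
\<close>

definition weighted_graph :: "real^'n^'n \<Rightarrow> bool" where
  "weighted_graph A \<longleftrightarrow> transpose A = A \<and> (\<forall>i j. 0 \<le> A $ i $ j)"

definition degree_vec :: "real^'n^'n \<Rightarrow> real^'n" where
  "degree_vec A = A *v vec 1"

definition min_degree :: "real^'n^'n \<Rightarrow> real" where
  "min_degree A = Min (range (\<lambda>i. degree_vec A $ i))"

definition max_degree :: "real^'n^'n \<Rightarrow> real" where
  "max_degree A = Max (range (\<lambda>i. degree_vec A $ i))"

definition diag_matrix :: "real^'n \<Rightarrow> real^'n^'n" where
  "diag_matrix d = (\<chi> i j. if i = j then d $ i else 0)"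

definition sqrt_deg_matrix :: "real^'n^'n \<Rightarrow> real^'n^'n" where
  "sqrt_deg_matrix A = diag_matrix (\<chi> i. sqrt (degree_vec A $ i))"

text \<open>The matrix \<open>D\<^sup>-\<^sup>1\<^sup>/\<^sup>2\<close>, meaningful when all degrees are positive.\<close>

definition inv_sqrt_deg_matrix :: "real^'n^'n \<Rightarrow> real^'n^'n" where
  "inv_sqrt_deg_matrix A = diag_matrix (\<chi> i. 1 / sqrt (degree_vec A $ i))"

definition norm_adj :: "real^'n^'n \<Rightarrow> real^'n^'n" where
  "norm_adj A = inv_sqrt_deg_matrix A ** A ** inv_sqrt_deg_matrix A"

definition kvec :: "real^'n^'n \<Rightarrow> real^'n" where
  "kvec A = (sqrt_deg_matrix A *v vec 1) /\<^sub>R norm (sqrt_deg_matrix A *v vec 1)"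

definition outer_product :: "real^'n \<Rightarrow> real^'n \<Rightarrow> real^'n^'n" where
  "outer_product u w = (\<chi> i j. u $ i * w $ j)"

definition charpoly :: "real^'n^'n \<Rightarrow> real poly" where
  "charpoly M = det (mat [:0, 1:] - map_matrix (\<lambda>a. [:a:]) M)"

text \<open>
  \<open>lam 1 \<ge> \<dots> \<ge> lam n\<close> are all the eigenvalues of \<open>M\<close>, each repeated according to its
  multiplicity as a root of the characteristic polynomial.  Values of \<open>lam\<close> outside
  \<open>{1..n}\<close> are irrelevant.
\<close>

definition ordered_eigenvalues :: "real^'n^'n \<Rightarrow> (nat \<Rightarrow> real) \<Rightarrow> bool" where
  "ordered_eigenvalues M lam \<longleftrightarrow>
     antimono_on {1..CARD('n)} lam \<and>
     charpoly M = (\<Prod>k = 1..CARD('n). [:- lam k, 1:])"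

definition Vol :: "real^'n^'n \<Rightarrow> 'n set \<Rightarrow> real" where
  "Vol A S = (\<Sum>i\<in>S. \<Sum>j\<in>S. A $ i $ j)"

definition cut_weight :: "real^'n^'n \<Rightarrow> 'n set \<Rightarrow> real" where
  "cut_weight A S = (\<Sum>i\<in>S. \<Sum>j\<in>- S. A $ i $ j)"

definition conductance :: "real^'n^'n \<Rightarrow> 'n set \<Rightarrow> ereal" where
  "conductance A S =
     (if min (Vol A S) (Vol A (- S)) = 0 then \<infinity>
      else ereal (cut_weight A S / min (Vol A S) (Vol A (- S))))"

definition sweep_cut :: "real^'n \<Rightarrow> real \<Rightarrow> 'n set" where
  "sweep_cut y t = {i. y $ i > t}"

definition proper_cut :: "'n set \<Rightarrow> bool" where
  "proper_cut S \<longleftrightarrow> S \<noteq> {} \<and> S \<noteq> UNIV"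

text \<open>
  There are only finitely many sweep cuts, so the infimum is a minimum unless the index set
  is empty, in which case it is \<open>\<infinity>\<close>.
\<close>

definition sweep_conductance :: "real^'n^'n \<Rightarrow> real^'n \<Rightarrow> ereal" where
  "sweep_conductance A y =
     (INF t\<in>{t. proper_cut (sweep_cut y t)}. conductance A (sweep_cut y t))"

definition good_thresholds :: "real^'n^'n \<Rightarrow> real \<Rightarrow> real^'n \<Rightarrow> real set" where
  "good_thresholds A \<psi> v =
     {t. proper_cut (sweep_cut v t) \<and> conductance A (sweep_cut v t) \<le> ereal \<psi>}"

text \<open>
  A nonempty set of good thresholds is a finite union of intervals \<open>[a, b)\<close> whose endpoints are
  consecutive distinct values of entries of \<open>v\<close>.  The distance to the entries is largest on
  such an interval at its midpoint, so the supremum is attained.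
\<close>

definition gap :: "real^'n^'n \<Rightarrow> real \<Rightarrow> real^'n \<Rightarrow> real" where
  "gap A \<psi> v =
     (if good_thresholds A \<psi> v = {} then 0
      else (SUP t\<in>good_thresholds A \<psi> v. Min (range (\<lambda>i. \<bar>v $ i - t\<bar>))))"

definition subspace_gap :: "real^'n^'n \<Rightarrow> real \<Rightarrow> (real^'n) set \<Rightarrow> real" where
  "subspace_gap A \<psi> V = (INF v\<in>{v \<in> V. norm v = 1}. gap A \<psi> v)"

definition spectral_dist :: "(nat \<Rightarrow> real) \<Rightarrow> nat \<Rightarrow> nat \<Rightarrow> real \<Rightarrow> real" where
  "spectral_dist lam n q \<mu> = Min ((\<lambda>k. \<bar>lam k - \<mu>\<bar>) ` {q<..n})"

end

theory Submission
  imports Defs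
begin

text \<open>
  Split \<open>x = p + r\<close> with \<open>p\<close> in the span of \<open>v\<^sub>1, \<dots>, v\<^sub>q\<close> and \<open>r\<close> orthogonal to it.  Expanding the
  residual in an orthonormal eigenbasis that extends \<open>v\<^sub>1, \<dots>, v\<^sub>q\<close> gives
  \<open>\<delta> \<parallel>r\<parallel> \<le> \<parallel>norm_adj A x - \<mu> x\<parallel>\<close>, so \<open>r\<close> is small; as every gap of a unit vector is at most 1, also
  \<open>\<parallel>r\<parallel>\<^sup>2 \<le> 1/2 \<le> \<parallel>p\<parallel>\<^sup>2\<close>.  Hence the entries of \<open>D\<^sup>-\<^sup>1\<^sup>/\<^sup>2 x\<close> differ from those of \<open>w = D\<^sup>-\<^sup>1\<^sup>/\<^sup>2 p\<close> by
  less than the gap of \<open>w\<close>, and at a threshold attaining that gap both vectors have the same sweep cut.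
\<close>

section \<open>Orthonormal eigenbases of symmetric matrices\<close>

lemma symmetric_inner_matrix:
  fixes M :: "real^'n^'n"
  assumes "transpose M = M"
  shows "x \<bullet> (M *v y) = (M *v x) \<bullet> y"
  by (metis assms dot_lmul_matrix transpose_matrix_vector)

text \<open>A maximiser of the Rayleigh quotient on the compact unit sphere of \<open>S\<close> is
  an eigenvector: otherwise a small move along its residual would increase the quotient. Allowing
  any invariant \<open>S\<close> makes this applicable to orthogonal complements of
  eigenvectors.\<close>

lemma symmetric_matrix_eigenvector:
  fixes M :: "real^'n^'n"
  assumes sym: "transpose M = M" and S: "subspace S"
    and inv: "\<And>x. x \<in> S \<Longrightarrow> M *v x \<in> S" and nz: "\<exists>x\<in>S. x \<noteq> 0"
  shows "\<exists>u\<in>S. norm u = 1 \<and> (\<exists>c. M *v u = c *\<^sub>R u)"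
proof -
  let ?K = "S \<inter> sphere 0 1"
  obtain x where x: "x \<in> S" "x \<noteq> 0" using nz by blast
  have "(1 / norm x) *\<^sub>R x \<in> ?K"
    using x S by (auto simp: subspace_scale)
  then have ne: "?K \<noteq> {}" by blast
  have "compact ?K"
    using closed_subspace[OF S] by (metis compact_Int_closed compact_sphere inf_commute)
  moreover have "continuous_on ?K (\<lambda>u. u \<bullet> (M *v u))"
    by (intro continuous_intros matrix_vector_mult_linear_continuous_on)
  ultimately obtain u where u: "u \<in> ?K" and umax: "\<And>w. w \<in> ?K \<Longrightarrow> w \<bullet> (M *v w) \<le> u \<bullet> (M *v u)"
    using continuous_attains_sup[of ?K "\<lambda>u. u \<bullet> (M *v u)"] ne by blast
  define c where "c = u \<bullet> (M *v u)"
  have uS: "u \<in> S" and u1: "norm u = 1" using u by auto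
  have ray: "w \<bullet> (M *v w) \<le> c * (w \<bullet> w)" if "w \<in> S" for w
  proof (cases "w = 0")
    case False
    have "(1 / norm w) *\<^sub>R w \<in> ?K" using that False S by (auto simp: subspace_scale)
    from umax[OF this] have "(w \<bullet> (M *v w)) / (norm w)^2 \<le> c"
      by (simp add: c_def matrix_vector_mult_scaleR power2_eq_square)
    then show ?thesis using False by (simp add: field_simps power2_norm_eq_inner)
  qed simp
  \<comment> \<open>Invariance keeps \<open>z\<close> in \<open>S\<close>, so
    \<open>u + t *\<^sub>R z\<close> is an admissible competitor. For it \<open>ray\<close> becomes
    a quadratic inequality in \<open>t\<close> with linear coefficient
    \<open>2 * (z \<bullet> z)\<close>.\<close>
  define z where "z = c *\<^sub>R u - M *v u"
  have zS: "z \<in> S" unfolding z_def using S uS inv by (intro subspace_diff subspace_scale) auto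
  have quad: "0 \<le> t * (2 * (z \<bullet> z)) + t^2 * (c * (z \<bullet> z) - z \<bullet> (M *v z))" for t
  proof -
    have "u + t *\<^sub>R z \<in> S" using S uS zS by (intro subspace_add subspace_scale)
    from ray[OF this] have *: "(u + t *\<^sub>R z) \<bullet> (M *v (u + t *\<^sub>R z)) \<le> c * ((u + t *\<^sub>R z) \<bullet> (u + t *\<^sub>R z))" .
    have "u \<bullet> (M *v z) = z \<bullet> (M *v u)"
      using symmetric_inner_matrix[OF sym, of u z] by (simp add: inner_commute)
    then have 1: "(u + t *\<^sub>R z) \<bullet> (M *v (u + t *\<^sub>R z))
        = c + 2 * t * (z \<bullet> (M *v u)) + t^2 * (z \<bullet> (M *v z))"
      by (simp add: matrix_vector_right_distrib matrix_vector_mult_scaleR inner_simps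
          power2_eq_square c_def algebra_simps)
    have "u \<bullet> u = 1" using u1 by (simp add: norm_eq_1)
    then have 2: "(u + t *\<^sub>R z) \<bullet> (u + t *\<^sub>R z) = 1 + 2 * t * (z \<bullet> u) + t^2 * (z \<bullet> z)"
      by (simp add: inner_simps inner_commute power2_eq_square algebra_simps)
    have 3: "z \<bullet> z = c * (z \<bullet> u) - z \<bullet> (M *v u)"
      by (subst (2) z_def) (simp add: inner_simps)
    show ?thesis using * unfolding 1 2 3 by (simp add: algebra_simps)
  qed
  have "z = 0"
  proof (rule ccontr)
    assume "z \<noteq> 0"
    define a where "a = z \<bullet> z"
    define b where "b = c * (z \<bullet> z) - z \<bullet> (M *v z)"
    have a: "a > 0" using \<open>z \<noteq> 0\<close> by (simp add: a_def)
    have b: "b \<ge> 0" using ray[OF zS] by (simp add: b_def)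
    \<comment> \<open>The quadratic \<open>2 * a * t + b * t^2\<close> is negative for small
      negative \<open>t\<close>; the choice \<open>- a / (b + 1)\<close> stays defined when
      \<open>b = 0\<close>.\<close>
    have "0 \<le> (- a / (b + 1)) * (2 * a) + (- a / (b + 1))^2 * b"
      using quad[of "- a / (b + 1)"] by (simp add: a_def b_def)
    also have "\<dots> = - (a^2 * (b + 2)) / (b + 1)^2"
      using b by (simp add: divide_simps) (simp add: power2_eq_square algebra_simps)
    also have "\<dots> < 0" using a b by (simp add: divide_neg_pos)
    finally show False by simp
  qed
  then have "M *v u = c *\<^sub>R u" by (simp add: z_def)
  then show ?thesis using uS u1 by blast
qed

text \<open>The Rayleigh quotient of a unit eigenvector is its eigenvalue, so a bare set of vectors
  carries all the spectral data.\<close>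

definition orthonormal_eigenvectors :: "real^'n^'n \<Rightarrow> (real^'n) set \<Rightarrow> bool" where
  "orthonormal_eigenvectors M B \<longleftrightarrow>
     pairwise orthogonal B \<and> (\<forall>b\<in>B. norm b = 1 \<and> M *v b = (b \<bullet> (M *v b)) *\<^sub>R b)"

lemma orthonormal_eigenvectors_independent:
  "orthonormal_eigenvectors M B \<Longrightarrow> independent B"
  unfolding orthonormal_eigenvectors_def
  by (metis norm_zero pairwise_orthogonal_independent zero_neq_one)

lemma orthonormal_eigenvectors_finite:
  "orthonormal_eigenvectors M B \<Longrightarrow> finite B"
  using independent_imp_finite orthonormal_eigenvectors_independent by blast

text \<open>Take a superset of \<open>B\<^sub>0\<close> of largest cardinality, which exists because
  orthonormal sets are independent. Its orthogonal complement is \<open>M\<close>-invariant by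
  symmetry; were it nonzero, it would supply one more eigenvector.\<close>

lemma orthonormal_eigenbasis_extend:
  fixes M :: "real^'n^'n"
  assumes sym: "transpose M = M" and B0: "orthonormal_eigenvectors M B\<^sub>0"
  obtains B where "B\<^sub>0 \<subseteq> B" "orthonormal_eigenvectors M B" "span B = UNIV" "card B = CARD('n)"
proof -
  let ?P = "\<lambda>B. B\<^sub>0 \<subseteq> B \<and> orthonormal_eigenvectors M B"
  have bound: "\<forall>B. ?P B \<longrightarrow> card B < Suc CARD('n)"
    using independent_bound orthonormal_eigenvectors_independent by (fastforce simp: less_Suc_eq_le)
  then obtain B where B: "?P B" and max: "\<And>C. ?P C \<Longrightarrow> card C \<le> card B"
    using ex_has_greatest_nat[of ?P B\<^sub>0 card] B0 by blast
  have eig: "\<And>b. b \<in> B \<Longrightarrow> norm b = 1 \<and> M *v b = (b \<bullet> (M *v b)) *\<^sub>R b"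
    using B by (auto simp: orthonormal_eigenvectors_def)
  define S where "S = {x. \<forall>b\<in>B. x \<bullet> b = 0}"
  have S: "subspace S" by (auto simp: S_def subspace_def inner_simps)
  have inv: "M *v x \<in> S" if "x \<in> S" for x
  proof -
    have "(M *v x) \<bullet> b = 0" if "b \<in> B" for b
    proof -
      have "(M *v x) \<bullet> b = x \<bullet> (M *v b)" using symmetric_inner_matrix[OF sym] by metis
      also have "\<dots> = (b \<bullet> (M *v b)) * (x \<bullet> b)"
        using eig[OF that] by (metis inner_scaleR_right)
      finally show ?thesis using \<open>x \<in> S\<close> that by (simp add: S_def)
    qed
    then show ?thesis by (simp add: S_def)
  qed
  have triv: "x = 0" if "x \<in> S" for x
  proof (rule ccontr)
    assume "x \<noteq> 0"
    then obtain u c where u: "u \<in> S" "norm u = 1" "M *v u = c *\<^sub>R u"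
      using symmetric_matrix_eigenvector[OF sym S inv] \<open>x \<in> S\<close> by blast
    have nin: "u \<notin> B" using u by (auto simp: S_def)
    have "u \<bullet> u = 1" using u(2) by (simp add: norm_eq_1)
    then have "?P (insert u B)"
      using B u by (auto simp: orthonormal_eigenvectors_def pairwise_insert orthogonal_def S_def inner_commute)
    from max[OF this] nin orthonormal_eigenvectors_finite B show False by fastforce
  qed
  have "span B = UNIV"
  proof (rule ccontr)
    assume "span B \<noteq> UNIV"
    then obtain a where "a \<noteq> 0" "\<forall>x \<in> span B. a \<bullet> x = 0"
      using span_not_UNIV_orthogonal by blast
    then show False using triv[of a] by (auto simp: S_def span_base)
  qed
  moreover from this have "card B = CARD('n)"
    using B orthonormal_eigenvectors_independent
    by (metis DIM_cart DIM_real dim_UNIV dim_eq_card_independent dim_span mult.right_neutral)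
  ultimately show ?thesis using B that by blast
qed

lemma orthonormal_eigenbasis_expand:
  assumes "orthonormal_eigenvectors M B" "span B = UNIV"
  shows "(\<Sum>b\<in>B. (x \<bullet> b) *\<^sub>R b) = x"
  by (rule orthonormal_basis_expand)
    (use assms orthonormal_eigenvectors_finite in \<open>auto simp: orthonormal_eigenvectors_def\<close>)

lemma norm_sum_orthonormal:
  assumes "orthonormal_eigenvectors M B" "C \<subseteq> B"
  shows "(norm (\<Sum>b\<in>C. f b *\<^sub>R b))\<^sup>2 = (\<Sum>b\<in>C. (f b)\<^sup>2)"
proof -
  have "finite C" using assms orthonormal_eigenvectors_finite finite_subset by blast
  moreover have "pairwise (\<lambda>i j. orthogonal (f i *\<^sub>R i) (f j *\<^sub>R j)) C"
    using assms by (auto simp: orthonormal_eigenvectors_def pairwise_def orthogonal_def)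
  ultimately have "(norm (\<Sum>b\<in>C. f b *\<^sub>R b))\<^sup>2 = (\<Sum>b\<in>C. (norm (f b *\<^sub>R b))\<^sup>2)"
    by (rule norm_sum_Pythagorean)
  also have "\<dots> = (\<Sum>b\<in>C. (f b)\<^sup>2)"
    using assms by (intro sum.cong) (auto simp: orthonormal_eigenvectors_def)
  finally show ?thesis .
qed

section \<open>The characteristic polynomial in an eigenbasis\<close>

text \<open>Evaluation at \<open>s\<close> is a ring homomorphism, so it passes through the Leibniz
  expansion. This reduces polynomial determinants to real ones.\<close>

lemma poly_charpoly: "poly (charpoly M) s = det (mat s - M)"
proof -
  have *: "poly ((mat [:0, 1:] - map_matrix (\<lambda>a. [:a:]) M) $ i $ j) s = (mat s - M) $ i $ j" for i j
    by (simp add: mat_def map_matrix_def)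
  show ?thesis
    unfolding charpoly_def det_def poly_sum poly_mult poly_prod *
    by (intro sum.cong) (auto simp: sign_def)
qed

text \<open>The orthogonal matrix \<open>Q\<close> with the eigenvectors as columns diagonalises
  \<open>mat s - M\<close> for every real \<open>s\<close>; polynomials that agree at all reals are
  equal.\<close>

lemma charpoly_orthonormal_eigenbasis:
  fixes M :: "real^'n^'n"
  assumes B: "orthonormal_eigenvectors M B" and card: "card B = CARD('n)"
  shows "charpoly M = (\<Prod>b\<in>B. [:- (b \<bullet> (M *v b)), 1:])"
proof -
  obtain h where h: "bij_betw h (UNIV :: 'n set) B"
    using orthonormal_eigenvectors_finite[OF B] card
    by (metis finite_class.finite_UNIV finite_same_card_bij)
  define e where "e i = h i \<bullet> (M *v h i)" for i
  define Q where "Q = (\<chi> i j. h j $ i)"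
  have hB: "h i \<in> B" for i using h by (auto simp: bij_betw_def)
  have hh: "h i \<bullet> h j = (if i = j then 1 else 0)" for i j
  proof (cases "i = j")
    case False
    then have "h i \<noteq> h j" using h by (auto simp: bij_betw_def inj_def)
    then show ?thesis using False B hB by (auto simp: orthonormal_eigenvectors_def pairwise_def orthogonal_def)
  qed (use B hB in \<open>auto simp: orthonormal_eigenvectors_def norm_eq_1\<close>)
  have QtQ: "transpose Q ** Q = mat 1"
    using hh by (simp add: vec_eq_iff matrix_matrix_mult_def transpose_def Q_def mat_def inner_vec_def)
  then have QQt: "Q ** transpose Q = mat 1"
    using matrix_left_right_inverse by blast
  have det: "det (mat s - M) = (\<Prod>i\<in>UNIV. s - e i)" for s
  proof -
    have "column i ((mat s - M) ** Q) = (s - e i) *\<^sub>R h i" for i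
    proof -
      have cQ: "column i Q = h i" by (simp add: column_def Q_def vec_eq_iff)
      have "column i ((mat s - M) ** Q) = (mat s - M) *v h i"
        unfolding cQ[symmetric] by (simp add: vec_eq_iff column_def matrix_matrix_mult_def matrix_vector_mult_def)
      also have "\<dots> = s *\<^sub>R h i - M *v h i"
        by (simp add: matrix_vector_mult_diff_rdistrib)
          (simp add: vec_eq_iff matrix_vector_mult_def mat_def mult_delta_left)
      also have "M *v h i = e i *\<^sub>R h i"
        using B hB unfolding orthonormal_eigenvectors_def e_def by blast
      finally show ?thesis by (simp add: algebra_simps)
    qed
    then have entry: "((mat s - M) ** Q) $ k $ j = (s - e j) * h j $ k" for k j
      by (metis column_def vec_lambda_beta vector_scaleR_component real_scaleR_def)
    \<comment> \<open>Conjugation by \<open>Q\<close> preserves the determinant, and orthonormality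
      makes the result diagonal.\<close>
    let ?D = "transpose Q ** ((mat s - M) ** Q)"
    have Dij: "?D $ i $ j = (s - e j) * (h i \<bullet> h j)" for i j
      unfolding matrix_matrix_mult_def[of "transpose Q"]
      by (simp add: entry) (simp add: transpose_def Q_def inner_vec_def sum_distrib_left mult_ac)
    have "det ?D = det (transpose Q ** Q) * det (mat s - M)"
      by (simp only: det_mul mult_ac)
    then have "det (mat s - M) = det ?D" by (simp add: QtQ)
    also have "\<dots> = (\<Prod>i\<in>UNIV. ?D $ i $ i)"
      by (rule det_diagonal) (simp add: Dij hh)
    also have "\<dots> = (\<Prod>i\<in>UNIV. s - e i)" by (simp add: Dij hh)
    finally show ?thesis .
  qed
  have "poly (charpoly M) s = poly (\<Prod>b\<in>B. [:- (b \<bullet> (M *v b)), 1:]) s" for s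
    unfolding poly_charpoly det poly_prod
    using prod.reindex_bij_betw[OF h, of "\<lambda>b. poly [:- (b \<bullet> (M *v b)), 1:] s"]
    by (simp add: e_def)
  then show ?thesis by (simp add: poly_eq_poly_eq_iff[symmetric] fun_eq_iff)
qed

text \<open>
  Since multiplicities count, the factors belonging to \<open>v 1, \<dots>, v q\<close> have to be cancelled
  before evaluating at the eigenvalue of \<open>b\<close>.
\<close>

lemma remaining_eigenvalues:
  fixes M :: "real^'n^'n"
  assumes B: "orthonormal_eigenvectors M B" "card B = CARD('n)"
    and lam: "charpoly M = (\<Prod>k = 1..CARD('n). [:- lam k, 1:])"
    and q: "q < CARD('n)" and inj: "inj_on v {1..q}" and sub: "v ` {1..q} \<subseteq> B"
    and ev: "\<And>j. j \<in> {1..q} \<Longrightarrow> v j \<bullet> (M *v v j) = lam j"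
    and b: "b \<in> B - v ` {1..q}"
  shows "b \<bullet> (M *v b) \<in> lam ` {q<..CARD('n)}"
proof -
  define e where "e b = b \<bullet> (M *v b)" for b
  have fin: "finite B" using B orthonormal_eigenvectors_finite by blast
  have "(\<Prod>b\<in>v ` {1..q}. [:- e b, 1:]) = (\<Prod>k = 1..q. [:- lam k, 1:])"
    using inj ev by (simp add: prod.reindex e_def)
  moreover have "(\<Prod>b\<in>B. [:- e b, 1:])
      = (\<Prod>b\<in>B - v ` {1..q}. [:- e b, 1:]) * (\<Prod>b\<in>v ` {1..q}. [:- e b, 1:])"
    by (rule prod.subset_diff[OF sub fin])
  moreover have "(\<Prod>k = 1..CARD('n). [:- lam k, 1:])
      = (\<Prod>k\<in>{1..CARD('n)} - {1..q}. [:- lam k, 1:]) * (\<Prod>k = 1..q. [:- lam k, 1:])"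
    by (rule prod.subset_diff) (use q in auto)
  moreover have "{1..CARD('n)} - {1..q} = {q<..CARD('n)}" by auto
  \<comment> \<open>A product of monic factors is nonzero and can be cancelled.\<close>
  moreover have "(\<Prod>k = 1..q. [:- lam k, 1:]) \<noteq> 0" by simp
  ultimately have "(\<Prod>b\<in>B - v ` {1..q}. [:- e b, 1:]) = (\<Prod>k\<in>{q<..CARD('n)}. [:- lam k, 1:])"
    using charpoly_orthonormal_eigenbasis[OF B] lam by (simp add: e_def)
  \<comment> \<open>At \<open>e b\<close> the factor of \<open>b\<close> itself vanishes, hence so
    does some factor with index \<open>k > q\<close>.\<close>
  then have "poly (\<Prod>k\<in>{q<..CARD('n)}. [:- lam k, 1:]) (e b)
      = poly (\<Prod>b\<in>B - v ` {1..q}. [:- e b, 1:]) (e b)" by simp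
  also have "\<dots> = 0" using b fin by (auto simp: poly_prod)
  finally show ?thesis by (auto simp: poly_prod e_def)
qed

text \<open>\<open>p\<close> is the orthogonal projection of \<open>x\<close> onto the span. In the
  eigenbasis the residual multiplies each coordinate of \<open>x\<close> by eigenvalue minus
  \<open>\<mu>\<close>, which off the span is at least \<open>spectral_dist\<close> in absolute
  value. The indices \<open>k > q\<close> are separated by position, so \<open>lam k\<close> may
  coincide with some \<open>lam j\<close> for \<open>j \<le> q\<close>.\<close>

lemma eigenspace_distance_le_residual:
  fixes M :: "real^'n^'n"
  assumes sym: "transpose M = M"
    and lam: "charpoly M = (\<Prod>k = 1..CARD('n). [:- lam k, 1:])"
    and q: "q < CARD('n)"
    and on: "\<And>i j. i \<in> {1..q} \<Longrightarrow> j \<in> {1..q} \<Longrightarrow> v i \<bullet> v j = (if i = j then 1 else 0)"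
    and ev: "\<And>j. j \<in> {1..q} \<Longrightarrow> M *v v j = lam j *\<^sub>R v j"
  obtains p where "p \<in> span (v ` {1..q})"
    and "(norm p)\<^sup>2 + (norm (x - p))\<^sup>2 = (norm x)\<^sup>2"
    and "spectral_dist lam CARD('n) q \<mu> * norm (x - p) \<le> norm (M *v x - \<mu> *\<^sub>R x)"
proof -
  let ?W = "v ` {1..q}"
  have inj: "inj_on v {1..q}"
    by (rule inj_onI) (metis on zero_neq_one)
  have ev': "v j \<bullet> (M *v v j) = lam j" if "j \<in> {1..q}" for j
    using on[OF that that] ev[OF that] by simp
  have "orthonormal_eigenvectors M ?W"
    unfolding orthonormal_eigenvectors_def
  proof (intro conjI ballI)
    show "pairwise orthogonal ?W"
      using on by (force simp: pairwise_def orthogonal_def)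
  next
    fix b assume "b \<in> ?W"
    then show "norm b = 1" using on by (auto simp: norm_eq_1)
  next
    fix b assume "b \<in> ?W"
    then show "M *v b = (b \<bullet> (M *v b)) *\<^sub>R b" using ev' ev by fastforce
  qed
  from orthonormal_eigenbasis_extend[OF sym this]
  obtain B where B: "?W \<subseteq> B" "orthonormal_eigenvectors M B" "span B = UNIV" "card B = CARD('n)"
    by metis
  have fin: "finite B" using B orthonormal_eigenvectors_finite by blast
  define p where "p = (\<Sum>b\<in>?W. (x \<bullet> b) *\<^sub>R b)"
  have x: "x = (\<Sum>b\<in>B. (x \<bullet> b) *\<^sub>R b)"
    using orthonormal_eigenbasis_expand[OF B(2,3)] by simp
  have "(\<Sum>b\<in>B. (x \<bullet> b) *\<^sub>R b) = (\<Sum>b\<in>B - ?W. (x \<bullet> b) *\<^sub>R b) + p"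
    unfolding p_def by (rule sum.subset_diff[OF B(1) fin])
  from trans[OF x this] have r: "x - p = (\<Sum>b\<in>B - ?W. (x \<bullet> b) *\<^sub>R b)" by (simp only: diff_eq_eq)
  have np: "(norm p)\<^sup>2 = (\<Sum>b\<in>?W. (x \<bullet> b)\<^sup>2)"
    unfolding p_def using norm_sum_orthonormal[OF B(2,1)] .
  have nr: "(norm (x - p))\<^sup>2 = (\<Sum>b\<in>B - ?W. (x \<bullet> b)\<^sup>2)"
    unfolding r using norm_sum_orthonormal[OF B(2)] by blast
  have nx: "(norm y)\<^sup>2 = (\<Sum>b\<in>B. (y \<bullet> b)\<^sup>2)" for y
    using norm_sum_orthonormal[OF B(2) subset_refl, of "\<lambda>b. y \<bullet> b"]
      orthonormal_eigenbasis_expand[OF B(2,3), of y] by simp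
  have pyth: "(norm p)\<^sup>2 + (norm (x - p))\<^sup>2 = (norm x)\<^sup>2"
    unfolding np nr nx[of x] using sum.subset_diff[OF B(1) fin, of "\<lambda>b. (x \<bullet> b)\<^sup>2"] by simp
  define d where "d = spectral_dist lam CARD('n) q \<mu>"
  have ne: "{q<..CARD('n)} \<noteq> {}" using q by auto
  \<comment> \<open>Since \<open>q < CARD('n)\<close>, the \<open>Min\<close> ranges over a nonempty
    set.\<close>
  have d0: "0 \<le> d" unfolding d_def spectral_dist_def using ne by simp
  have coef: "(M *v x - \<mu> *\<^sub>R x) \<bullet> b = (b \<bullet> (M *v b) - \<mu>) * (x \<bullet> b)" if "b \<in> B" for b
  proof -
    have "(M *v x) \<bullet> b = x \<bullet> (M *v b)" using symmetric_inner_matrix[OF sym] by metis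
    also have "M *v b = (b \<bullet> (M *v b)) *\<^sub>R b"
      using B(2) that by (simp add: orthonormal_eigenvectors_def)
    finally show ?thesis by (simp add: inner_simps algebra_simps)
  qed
  have "(d * norm (x - p))\<^sup>2 = (\<Sum>b\<in>B - ?W. d\<^sup>2 * (x \<bullet> b)\<^sup>2)"
    by (simp add: power_mult_distrib nr sum_distrib_left)
  also have "\<dots> \<le> (\<Sum>b\<in>B - ?W. ((M *v x - \<mu> *\<^sub>R x) \<bullet> b)\<^sup>2)"
  proof (rule sum_mono)
    fix b assume b: "b \<in> B - ?W"
    then have "b \<bullet> (M *v b) \<in> lam ` {q<..CARD('n)}"
      using remaining_eigenvalues[OF B(2,4) lam q inj B(1) ev'] by blast
    then have "d \<le> \<bar>b \<bullet> (M *v b) - \<mu>\<bar>"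
      unfolding d_def spectral_dist_def by (auto intro!: Min_le)
    then have "d\<^sup>2 \<le> (b \<bullet> (M *v b) - \<mu>)\<^sup>2"
      using d0 by (metis power2_abs power_mono)
    then show "d\<^sup>2 * (x \<bullet> b)\<^sup>2 \<le> ((M *v x - \<mu> *\<^sub>R x) \<bullet> b)\<^sup>2"
      using b by (simp add: coef power_mult_distrib mult_right_mono)
  qed
  \<comment> \<open>Restoring the coordinates along the span completes the Parseval sum of the
    residual.\<close>
  also have "\<dots> \<le> (\<Sum>b\<in>B. ((M *v x - \<mu> *\<^sub>R x) \<bullet> b)\<^sup>2)"
    using fin by (intro sum_mono2) auto
  also have "\<dots> = (norm (M *v x - \<mu> *\<^sub>R x))\<^sup>2" by (simp add: nx)
  finally have "d * norm (x - p) \<le> norm (M *v x - \<mu> *\<^sub>R x)"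
    by (rule power2_le_imp_le) simp
  moreover have "p \<in> span ?W"
    unfolding p_def by (intro span_sum span_scale span_base)
  ultimately show ?thesis using that pyth d_def by blast
qed

section \<open>Gaps and sweep cuts\<close>

text \<open>A proper cut places \<open>t\<close> between two entries, both in
  \<open>[-1, 1]\<close>; the nearer of the two is within half of their difference.\<close>

lemma threshold_margin_le:
  fixes v :: "real^'n"
  assumes "norm v = 1" and "proper_cut (sweep_cut v t)"
  shows "Min (range (\<lambda>i. \<bar>v $ i - t\<bar>)) \<le> 1"
proof -
  obtain i j where ij: "v $ i > t" "\<not> v $ j > t"
    using assms(2) by (auto simp: proper_cut_def sweep_cut_def)
  have "Min (range (\<lambda>i. \<bar>v $ i - t\<bar>)) \<le> \<bar>v $ i - t\<bar>"
    and "Min (range (\<lambda>i. \<bar>v $ i - t\<bar>)) \<le> \<bar>v $ j - t\<bar>"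
    by (auto intro: Min_le)
  moreover have "\<bar>v $ i\<bar> \<le> 1" "\<bar>v $ j\<bar> \<le> 1"
    using component_le_norm_cart[of v] assms(1) by auto
  ultimately show ?thesis using ij by linarith
qed

text \<open>Boundedness makes the real \<open>SUP\<close> in \<open>gap\<close> a true
  supremum.\<close>

lemma threshold_margin_bdd_above:
  fixes v :: "real^'n"
  assumes "norm v = 1"
  shows "bdd_above ((\<lambda>t. Min (range (\<lambda>i. \<bar>v $ i - t\<bar>))) ` good_thresholds A \<psi> v)"
  using threshold_margin_le[OF assms] by (auto simp: bdd_above_def good_thresholds_def)

text \<open>This lower bound makes the real \<open>INF\<close> in \<open>subspace_gap\<close> a true
  infimum.\<close>

lemma gap_nonneg:
  fixes v :: "real^'n"
  assumes "norm v = 1"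
  shows "0 \<le> gap A \<psi> v"
proof (cases "good_thresholds A \<psi> v = {}")
  case False
  then obtain t where t: "t \<in> good_thresholds A \<psi> v" by blast
  have "0 \<le> Min (range (\<lambda>i. \<bar>v $ i - t\<bar>))" by simp
  also have "\<dots> \<le> (SUP t\<in>good_thresholds A \<psi> v. Min (range (\<lambda>i. \<bar>v $ i - t\<bar>)))"
    by (rule cSUP_upper[OF t threshold_margin_bdd_above[OF assms]])
  finally show ?thesis using False by (simp add: gap_def)
qed (simp add: gap_def)

lemma gap_le_1:
  fixes v :: "real^'n"
  assumes "norm v = 1"
  shows "gap A \<psi> v \<le> 1"
proof (cases "good_thresholds A \<psi> v = {}")
  case False
  then show ?thesis
    using threshold_margin_le[OF assms] by (auto simp: gap_def good_thresholds_def intro!: cSUP_least)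
qed (simp add: gap_def)

lemma subspace_gap_le:
  fixes v :: "real^'n"
  assumes "v \<in> V" "norm v = 1"
  shows "subspace_gap A \<psi> V \<le> gap A \<psi> v"
  unfolding subspace_gap_def
  by (rule cINF_lower) (use assms gap_nonneg in \<open>auto simp: bdd_below_def\<close>)

text \<open>No entry moves as far as its distance to the threshold, so none crosses it; the factor
  \<open>c\<close> only rescales the threshold to \<open>c * t\<close>.\<close>

lemma sweep_conductance_le_if_near:
  fixes u y :: "real^'n"
  assumes u: "norm u = 1" and c: "0 < c" and "0 \<le> \<epsilon>"
    and near: "\<And>i. \<bar>y $ i - c * u $ i\<bar> \<le> c * \<epsilon>" and gap: "\<epsilon> < gap A \<psi> u"
  shows "sweep_conductance A y \<le> ereal \<psi>"
proof -
  \<comment> \<open>A gap above \<open>\<epsilon> \<ge> 0\<close> cannot be the default value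
    0.\<close>
  have ne: "good_thresholds A \<psi> u \<noteq> {}" using gap \<open>0 \<le> \<epsilon>\<close> by (auto simp: gap_def)
  with gap have "\<epsilon> < (SUP t\<in>good_thresholds A \<psi> u. Min (range (\<lambda>i. \<bar>u $ i - t\<bar>)))"
    by (simp add: gap_def)
  \<comment> \<open>The strict inequality yields a threshold with margin above
    \<open>\<epsilon>\<close>, without appeal to attainment of the supremum.\<close>
  then obtain t where t: "t \<in> good_thresholds A \<psi> u" "\<epsilon> < Min (range (\<lambda>i. \<bar>u $ i - t\<bar>))"
    using less_cSUP_iff[OF ne threshold_margin_bdd_above[OF u]] by blast
  have "(y $ i > c * t) = (u $ i > t)" for i
  proof -
    have "\<epsilon> < \<bar>u $ i - t\<bar>" using t(2) by auto
    then have "c * \<epsilon> < c * \<bar>u $ i - t\<bar>" using c by simp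
    also have "\<dots> = \<bar>c * u $ i - c * t\<bar>"
      using c by (simp add: abs_mult right_diff_distrib[symmetric])
    finally have "(y $ i > c * t) = (c * u $ i > c * t)" using near[of i] by linarith
    then show ?thesis using c by simp
  qed
  then have "sweep_cut y (c * t) = sweep_cut u t" by (simp add: sweep_cut_def)
  then show ?thesis
    using t(1) unfolding sweep_conductance_def good_thresholds_def
    by (intro INF_lower2[of "c * t"]) auto
qed

section \<open>Degree scaling\<close>

lemma inv_sqrt_deg_component:
  "(inv_sqrt_deg_matrix A *v x) $ i = x $ i / sqrt (degree_vec A $ i)"
proof -
  have "(\<Sum>j\<in>UNIV. (if i = j then 1 / sqrt (degree_vec A $ i) else 0) * x $ j)
      = (\<Sum>j\<in>UNIV. if i = j then x $ j / sqrt (degree_vec A $ i) else 0)"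
    by (intro sum.cong) auto
  then show ?thesis
    by (simp add: inv_sqrt_deg_matrix_def diag_matrix_def matrix_vector_mult_def cong: if_cong)
qed

text \<open>This entrywise bound brings the minimum degree into the final estimate.\<close>

lemma inv_sqrt_deg_component_le:
  assumes "\<forall>i. 0 < degree_vec A $ i"
  shows "\<bar>(inv_sqrt_deg_matrix A *v x) $ i\<bar> \<le> norm x / sqrt (min_degree A)"
proof -
  have "min_degree A \<le> degree_vec A $ i" by (simp add: min_degree_def)
  moreover have "0 < min_degree A" using assms by (auto simp: min_degree_def)
  ultimately show ?thesis
    using component_le_norm_cart[of x i] assms[rule_format, of i]
    by (auto simp: inv_sqrt_deg_component abs_divide intro!: frac_le)
qed

text \<open>Each squared entry is divided by at most \<open>max_degree A\<close>; this brings the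
  maximum degree into the final estimate.\<close>

lemma norm_inv_sqrt_deg_ge:
  assumes "\<forall>i. 0 < degree_vec A $ i"
  shows "norm x / sqrt (max_degree A) \<le> norm (inv_sqrt_deg_matrix A *v x)"
proof (rule power2_le_imp_le)
  have dm: "degree_vec A $ i \<le> max_degree A" for i by (simp add: max_degree_def)
  then have pos: "0 < max_degree A" using assms less_le_trans by blast
  have sq: "(norm z)\<^sup>2 = (\<Sum>i\<in>UNIV. (z $ i)\<^sup>2)" for z :: "real^'a"
    by (simp add: norm_vec_def L2_set_def sum_nonneg)
  have "(norm x / sqrt (max_degree A))\<^sup>2 = (\<Sum>i\<in>UNIV. (x $ i)\<^sup>2 / max_degree A)"
    using pos by (simp add: power_divide sq sum_divide_distrib)
  also have "\<dots> \<le> (\<Sum>i\<in>UNIV. (x $ i)\<^sup>2 / degree_vec A $ i)"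
    using assms dm by (intro sum_mono divide_left_mono mult_pos_pos pos) auto
  also have "\<dots> = (norm (inv_sqrt_deg_matrix A *v x))\<^sup>2"
    using assms by (simp add: sq inv_sqrt_deg_component power_divide less_imp_le)
  finally show "(norm x / sqrt (max_degree A))\<^sup>2 \<le> (norm (inv_sqrt_deg_matrix A *v x))\<^sup>2" .
qed simp

lemma transpose_norm_adj:
  assumes "transpose A = A"
  shows "transpose (norm_adj A) = norm_adj A"
proof -
  have "transpose (inv_sqrt_deg_matrix A) = inv_sqrt_deg_matrix A"
    by (auto simp: transpose_def inv_sqrt_deg_matrix_def diag_matrix_def vec_eq_iff)
  then show ?thesis
    using assms by (simp add: norm_adj_def matrix_transpose_mul matrix_mul_assoc)
qed

section \<open>Deflation by \<open>kvec A\<close> and the combined estimate\<close>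

lemma outer_product_mult: "outer_product u w *v x = (w \<bullet> x) *\<^sub>R u"
  by (simp add: vec_eq_iff outer_product_def matrix_vector_mult_def inner_vec_def
      sum_distrib_left mult_ac)

lemma transpose_outer_product: "transpose (outer_product u u) = outer_product u u"
  by (simp add: vec_eq_iff outer_product_def transpose_def mult.commute)

theorem theorem4:
  fixes A :: "real^'n^'n"
    and \<psi> \<mu> \<delta> g :: real
    and q :: nat
    and lam :: "nat \<Rightarrow> real"
    and v :: "nat \<Rightarrow> real^'n"
    and V :: "(real^'n) set"
    and x :: "real^'n"
  assumes "weighted_graph A"
    and "\<forall>i. 0 < degree_vec A $ i"
    and "0 < \<psi>"
    and "1 \<le> q" and "q < CARD('n)"
    and "ordered_eigenvalues (norm_adj A - outer_product (kvec A) (kvec A)) lam"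
    and "\<forall>i\<in>{1..q}. \<forall>j\<in>{1..q}. v i \<bullet> v j = (if i = j then 1 else 0)"
    and "\<forall>j\<in>{1..q}. v j \<bullet> kvec A = 0"
    and "\<forall>j\<in>{1..q}. norm_adj A *v v j = lam j *\<^sub>R v j"
    and "V = span ((\<lambda>j. inv_sqrt_deg_matrix A *v v j) ` {1..q})"
    and "g = subspace_gap A \<psi> V"
    and "norm x = 1" and "x \<bullet> kvec A = 0"
    and "\<mu> = x \<bullet> (norm_adj A *v x)"
    and "\<delta> = spectral_dist lam CARD('n) q \<mu>"
    and "norm (norm_adj A *v x - \<mu> *\<^sub>R x)
           < 1 / sqrt 2 * sqrt (min_degree A / max_degree A) * \<delta> * g"
  shows "sweep_conductance A (inv_sqrt_deg_matrix A *v x) \<le> ereal \<psi>"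
proof -
  note deg = assms(2)
  let ?T = "inv_sqrt_deg_matrix A"
  define M where "M = norm_adj A - outer_product (kvec A) (kvec A)"
  define a b where "a = sqrt (min_degree A)" and "b = sqrt (max_degree A)"
  \<comment> \<open>The ordered spectrum belongs to the deflated matrix \<open>M\<close>, which acts
    as \<open>norm_adj A\<close> on \<open>x\<close> and every \<open>v j\<close>.\<close>
  have Mx: "M *v z = norm_adj A *v z" if "z \<bullet> kvec A = 0" for z
    using that by (simp add: M_def matrix_vector_mult_diff_rdistrib outer_product_mult inner_commute)
  have "transpose (norm_adj A) = norm_adj A"
    using assms(1) transpose_norm_adj by (auto simp: weighted_graph_def)
  then have sym: "transpose M = M"
    using transpose_outer_product[of "kvec A"]
    by (simp add: M_def vec_eq_iff transpose_def)
  have lam: "charpoly M = (\<Prod>k = 1..CARD('n). [:- lam k, 1:])"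
    using assms(6) by (simp add: ordered_eigenvalues_def M_def)
  have ev: "M *v v j = lam j *\<^sub>R v j" if "j \<in> {1..q}" for j
    using that assms(8,9) Mx by metis
  obtain p where p: "p \<in> span (v ` {1..q})" "(norm p)\<^sup>2 + (norm (x - p))\<^sup>2 = (norm x)\<^sup>2"
      "\<delta> * norm (x - p) \<le> norm (M *v x - \<mu> *\<^sub>R x)"
    using eigenspace_distance_le_residual[OF sym lam assms(5) _ ev, where x = x and \<mu> = \<mu>] assms(7,15)
    by metis
  have TV: "?T *v z \<in> V" if "z \<in> span (v ` {1..q})" for z
  proof -
    have "V = span ((\<lambda>z. ?T *v z) ` (v ` {1..q}))" by (simp add: assms(10) image_image)
    also have "\<dots> = (\<lambda>z. ?T *v z) ` span (v ` {1..q})"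
      by (rule linear_span_image) (rule matrix_vector_mul_linear)
    finally show ?thesis using that by blast
  qed
  have a: "0 < a" using deg by (auto simp: a_def min_degree_def)
  have ab: "a \<le> b"
  proof -
    have "min_degree A \<le> degree_vec A $ undefined" "degree_vec A $ undefined \<le> max_degree A"
      by (simp_all add: min_degree_def max_degree_def)
    then show ?thesis by (simp add: a_def b_def)
  qed
  with a have b: "0 < b" by simp
  define w where "w = ?T *v p"
  have "\<delta> \<ge> 0"
    using assms(5) by (simp add: assms(15) spectral_dist_def)
  have hyp: "norm (M *v x - \<mu> *\<^sub>R x) < 1 / sqrt 2 * (a / b) * \<delta> * g"
    using assms(16) Mx[OF assms(13)] by (simp add: a_def b_def real_sqrt_divide)
  \<comment> \<open>The strict upper bound on a norm forces \<open>\<delta>\<close> and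
    \<open>g\<close> to be positive.\<close>
  then have "0 < (1 / sqrt 2 * (a / b)) * (\<delta> * g)" by (smt (verit) norm_ge_zero mult.assoc)
  then have "0 < \<delta> * g" by (rule zero_less_mult_pos) (use a b in simp)
  with \<open>\<delta> \<ge> 0\<close> have \<delta>: "0 < \<delta>" and g: "0 < g" by (auto simp: zero_less_mult_iff)
  have "\<delta> * norm (x - p) < \<delta> * (1 / sqrt 2 * (a / b) * g)"
    using p(3) hyp by (simp add: mult_ac)
  then have r: "norm (x - p) < 1 / sqrt 2 * (a / b) * g" using \<delta> by (simp only: mult_less_cancel_left_pos)
  have norm_pos: "0 < norm (?T *v z)" if "z \<noteq> 0" for z
  proof -
    have "0 < norm z / sqrt (max_degree A)" using that b by (simp add: b_def)
    then show ?thesis using norm_inv_sqrt_deg_ge[OF deg, of z] by linarith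
  qed
  have unit: "(1 / norm (?T *v z)) *\<^sub>R (?T *v z) \<in> V \<and> norm ((1 / norm (?T *v z)) *\<^sub>R (?T *v z)) = 1"
    if "z \<in> span (v ` {1..q})" "z \<noteq> 0" for z
    using TV[OF that(1)] norm_pos[OF that(2)] assms(10) by (auto intro!: span_scale)
  \<comment> \<open>As \<open>1 \<le> q\<close>, the space \<open>V\<close> contains a unit vector;
    this bounds the infimum \<open>g\<close> by 1.\<close>
  have "v 1 \<noteq> 0" using assms(4,7) by force
  moreover have "v 1 \<in> span (v ` {1..q})" using assms(4) by (intro span_base) auto
  ultimately obtain z where "z \<in> V" "norm z = 1" using unit by blast
  then have "g \<le> 1" unfolding assms(11)
    using subspace_gap_le gap_le_1 order_trans by blast
  \<comment> \<open>Since \<open>a \<le> b\<close> and \<open>g \<le> 1\<close>, the remainder has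
    norm at most \<open>1 / sqrt 2\<close>, so by Pythagoras \<open>norm p\<close> is at least that.
    The same constant then cancels when \<open>\<epsilon>\<close> is compared with
    \<open>g\<close>.\<close>
  have "a / b * g \<le> 1 * 1"
    using a b ab g \<open>g \<le> 1\<close> by (intro mult_mono) auto
  then have "1 / sqrt 2 * (a / b * g) \<le> 1 / sqrt 2"
    by (intro mult_left_le) auto
  with r have "norm (x - p) \<le> 1 / sqrt 2" by (simp add: mult.assoc)
  then have "(norm (x - p))\<^sup>2 \<le> (1 / sqrt 2)\<^sup>2" by (intro power_mono) auto
  then have "(1 / sqrt 2)\<^sup>2 \<le> (norm p)\<^sup>2" using p(2) assms(12) by (simp add: power_divide)
  then have np: "1 / sqrt 2 \<le> norm p" by (rule power2_le_imp_le) simp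
  then have "p \<noteq> 0" by auto
  define u where "u = (1 / norm w) *\<^sub>R w"
  have w: "0 < norm w" using norm_pos[OF \<open>p \<noteq> 0\<close>] by (simp add: w_def)
  have u: "u \<in> V" "norm u = 1" using unit[OF p(1) \<open>p \<noteq> 0\<close>] by (auto simp: u_def w_def)
  \<comment> \<open>\<open>norm (x - p) / a\<close> bounds the entrywise deviation from
    \<open>w\<close>; division by \<open>norm w\<close> expresses it on the scale of the unit vector
    \<open>u\<close>.\<close>
  define \<epsilon> where "\<epsilon> = norm (x - p) / a / norm w"
  have nw: "norm p / b \<le> norm w"
    using norm_inv_sqrt_deg_ge[OF deg] by (simp add: b_def w_def)
  have "norm (x - p) / a < 1 / sqrt 2 / b * g"
    using r a b by (simp add: field_simps)
  also have "\<dots> \<le> norm p / b * g"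
    using np b g by (intro mult_right_mono divide_right_mono) auto
  also have "\<dots> \<le> norm w * g" using nw g by (intro mult_right_mono) auto
  finally have "\<epsilon> < g" unfolding \<epsilon>_def using w by (simp only: pos_divide_less_eq mult.commute)
  also have "g \<le> gap A \<psi> u" unfolding assms(11) using subspace_gap_le[OF u] .
  finally have gap: "\<epsilon> < gap A \<psi> u" .
  show ?thesis
  proof (rule sweep_conductance_le_if_near[OF u(2) w _ _ gap])
    show "0 \<le> \<epsilon>" using a by (simp add: \<epsilon>_def)
    fix i
    have "(?T *v x) $ i - norm w * u $ i = (?T *v (x - p)) $ i"
      using w by (simp add: u_def w_def matrix_vector_mult_diff_distrib)
    also have "\<bar>\<dots>\<bar> \<le> norm (x - p) / a"
      using inv_sqrt_deg_component_le[OF deg] by (simp add: a_def)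
    also have "\<dots> = norm w * \<epsilon>" using w by (simp add: \<epsilon>_def)
    finally show "\<bar>(?T *v x) $ i - norm w * u $ i\<bar> \<le> norm w * \<epsilon>" .
  qed
qed

end
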